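(* For every $n\ge1$ and every $\sigma\in B_n$, $$\mathrm{Rmil_B}\,\sigma=\mathrm{Max}(\text{A-code}\,\sigma)\qquad\text{and}\qquad \mathrm{Lmap_B}\,\sigma=\mathrm{Rmil_B}(\text{A-code}\,\sigma).$$
   Context: $B_n$ is the group of bijections $\sigma$ of $\{\pm1,\ldots,\pm n\}$ with $\sigma(-i)=-\sigma(i)$, written $\sigma_1\cdots\sigma_n$ with $\sigma_i=\sigma(i)$; products are composition and $\sigma^{-1}$ is the inverse. The Lehmer code is $\mathrm{Leh}\,\sigma=(a_1,\ldots,a_n)$ with $a_i=\mathrm{sign}(\sigma_i)\cdot|\{j\le i: |\sigma_j|\le|\sigma_i|\}|$, and the A-code of $\sigma$ is $\mathrm{Leh}(\sigma^{-1})$. For an integer word $\omega=\omega_1\cdots\omega_n$: $\mathrm{Lmap_B}\,\omega=\{i:\omega_i>|\omega_j|\ \forall j<i\}$, $\mathrm{Rmil_B}\,\omega=\{\omega_i:0<\omega_i<|\omega_j|\ \forall j>i\}$ (applied to $\sigma$ via its word $\sigma_1\cdots\sigma_n$, and to codes as words). For a sequence $a$, $\mathrm{Max}\,a=\{i:a_i=i\}$.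
   Formalization: In Lmap_B the extra condition ω_i > 0 is required (the convention ω_0 = 0), which matters only at i = 1; without it the second equality fails whenever σ_1 < 0, e.g. n = 1, σ = −1. *)

theory Defs
  imports "HOL-Combinatorics.Permutations"
begin

text \<open>
  Words and sequences of length \<open>n\<close> are functions on \<^typ>\<open>int\<close> of which only the values at the
  positions \<open>1, \<dots>, n\<close> matter; every statistic below takes the length \<open>n\<close> and is restricted to these
  positions. A signed permutation \<open>\<sigma>\<close>, restricted to \<open>1, \<dots>, n\<close>, is thus its own word
  \<open>\<sigma>\<^sub>1 \<dots> \<sigma>\<^sub>n\<close>.
\<close>

text \<open>
  By \<^const>\<open>permutes\<close>, the elements of \<open>B\<^sub>n\<close> are extended by the identity outside
  \<open>{\<plusminus>1, \<dots>, \<plusminus>n}\<close>; so the group product is \<open>\<circ>\<close> and the group inverse is \<^term>\<open>inv \<sigma>\<close>.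
\<close>

definition signed_perms :: "nat \<Rightarrow> (int \<Rightarrow> int) set" where
  "signed_perms n =
     {\<sigma>. \<sigma> permutes ({- int n..- 1} \<union> {1..int n}) \<and>
         (\<forall>i \<in> {- int n..- 1} \<union> {1..int n}. \<sigma> (- i) = - \<sigma> i)}"

definition Leh :: "(int \<Rightarrow> int) \<Rightarrow> int \<Rightarrow> int" where
  "Leh \<sigma> i = sgn (\<sigma> i) * int (card {j \<in> {1..i}. \<bar>\<sigma> j\<bar> \<le> \<bar>\<sigma> i\<bar>})"

definition A_code :: "(int \<Rightarrow> int) \<Rightarrow> int \<Rightarrow> int" where
  "A_code \<sigma> = Leh (inv \<sigma>)"

text \<open>
  A left-to-right maximum place must carry a positive letter. For \<open>i > 1\<close> this follows from the
  comparison with the earlier letters; for \<open>i = 1\<close>, where that comparison is vacuous, it is the usual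
  convention \<open>\<omega>\<^sub>0 = 0\<close>. Without it \<open>1\<close> would be in \<open>Lmap\<^sub>B \<omega>\<close> for every \<open>\<omega>\<close>, even if \<open>\<omega>\<^sub>1 < 0\<close>.
\<close>

definition Lmap_B :: "nat \<Rightarrow> (int \<Rightarrow> int) \<Rightarrow> int set" where
  "Lmap_B n \<omega> = {i \<in> {1..int n}. 0 < \<omega> i \<and> (\<forall>j \<in> {1..<i}. \<bar>\<omega> j\<bar> < \<omega> i)}"

definition Rmil_B :: "nat \<Rightarrow> (int \<Rightarrow> int) \<Rightarrow> int set" where
  "Rmil_B n \<omega> = {\<omega> i | i. i \<in> {1..int n} \<and> 0 < \<omega> i \<and> (\<forall>j \<in> {i<..int n}. \<omega> i < \<bar>\<omega> j\<bar>)}"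

definition Max_places :: "nat \<Rightarrow> (int \<Rightarrow> int) \<Rightarrow> int set" where
  "Max_places n a = {i \<in> {1..int n}. a i = i}"

end

theory Submission
  imports Defs
begin

text \<open>
  Inversion exchanges places and letters, so \<open>Lmap\<^sub>B \<sigma> = Rmil\<^sub>B \<sigma>\<^sup>-\<^sup>1\<close>, and it remains to compare a word
  \<open>w\<close> (here \<open>\<sigma>\<^sup>-\<^sup>1\<close>) with its own Lehmer code. The code has \<open>a\<^sub>k = k\<close> exactly when \<open>w\<^sub>k\<close> dominates all
  earlier letters, whence \<open>Lmap\<^sub>B w = Max (Leh w)\<close>. Moreover \<open>w\<close> and \<open>Leh w\<close> have their right-to-left
  minima at the same places, and there they take the same value, because all letters smaller than a
  right-to-left minimum occur before it; whence \<open>Rmil\<^sub>B w = Rmil\<^sub>B (Leh w)\<close>.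
\<close>

section \<open>Signed permutations, their inverses and absolute values\<close>

lemma signed_perms_permutes:
  "\<sigma> \<in> signed_perms n \<Longrightarrow> \<sigma> permutes ({- int n..- 1} \<union> {1..int n})"
  by (simp add: signed_perms_def)

lemma signed_perms_uminus:
  assumes "\<sigma> \<in> signed_perms n"
  shows "\<sigma> (- i) = - \<sigma> i"
proof (cases "i \<in> {- int n..- 1} \<union> {1..int n}")
  case True
  then show ?thesis using assms by (simp add: signed_perms_def)
next
  case False
  \<comment> \<open>The support is symmetric about 0, so \<open>i\<close> and \<open>- i\<close> are
    both fixed points; oddness thus holds for all integers.\<close>
  then have "- i \<notin> {- int n..- 1} \<union> {1..int n}" by auto
  with False show ?thesis
    using permutes_not_in[OF signed_perms_permutes[OF assms]] by metis
qed

lemma signed_perms_inv: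
  assumes "\<sigma> \<in> signed_perms n"
  shows "inv \<sigma> \<in> signed_perms n"
proof -
  note p = signed_perms_permutes[OF assms]
  have "inv \<sigma> (- i) = - inv \<sigma> i" for i
    by (metis signed_perms_uminus[OF assms] permutes_inverses[OF p])
  then show ?thesis
    using permutes_inv[OF p] by (simp add: signed_perms_def)
qed

lemma signed_perms_inv_inv: "\<sigma> \<in> signed_perms n \<Longrightarrow> inv (inv \<sigma>) = \<sigma>"
  using permutes_bij[OF signed_perms_permutes] by (rule inv_inv_eq)

lemma signed_perms_abs_in:
  assumes "\<sigma> \<in> signed_perms n" and "i \<in> {1..int n}"
  shows "\<bar>\<sigma> i\<bar> \<in> {1..int n}"
proof -
  have "\<sigma> i \<in> {- int n..- 1} \<union> {1..int n}"
    using assms(2) permutes_in_image[OF signed_perms_permutes[OF assms(1)], of i] by blast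
  then show ?thesis by auto
qed

text \<open>Oddness lets signs be pulled out, so forgetting signs turns \<open>\<sigma>\<close> into
  an ordinary permutation of \<open>{1..int n}\<close> whose inverse comes from
  \<open>inv \<sigma>\<close> in the same way.\<close>

lemma signed_perms_abs_inv:
  assumes "\<sigma> \<in> signed_perms n" and "i \<in> {1..int n}"
  shows "\<bar>inv \<sigma> \<bar>\<sigma> i\<bar>\<bar> = i"
proof -
  have "inv \<sigma> (\<sigma> i) = i"
    using permutes_inverses(2)[OF signed_perms_permutes[OF assms(1)]] .
  then show ?thesis
    using assms(2) signed_perms_uminus[OF signed_perms_inv[OF assms(1)], of "\<sigma> i"]
    by (auto simp: abs_if)
qed

lemma signed_perms_abs_inv':
  assumes "\<sigma> \<in> signed_perms n" and "i \<in> {1..int n}"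
  shows "\<bar>\<sigma> \<bar>inv \<sigma> i\<bar>\<bar> = i"
  using signed_perms_abs_inv[OF signed_perms_inv[OF assms(1)] assms(2)]
  by (simp add: signed_perms_inv_inv[OF assms(1)])

lemma signed_perms_inj_on_abs:
  "\<sigma> \<in> signed_perms n \<Longrightarrow> inj_on (\<lambda>i. \<bar>\<sigma> i\<bar>) {1..int n}"
  by (metis (no_types, lifting) inj_onI signed_perms_abs_inv)

section \<open>Exchange of places and letters under inversion\<close>

lemma Rmil_B_eq_Lmap_B_inv:
  assumes "\<sigma> \<in> signed_perms n"
  shows "Rmil_B n \<sigma> = Lmap_B n (inv \<sigma>)"
proof (intro set_eqI iffI)
  fix k assume "k \<in> Rmil_B n \<sigma>"
  then obtain i where i: "i \<in> {1..int n}" "k = \<sigma> i" "0 < k"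
    and less: "\<And>j. j \<in> {i<..int n} \<Longrightarrow> k < \<bar>\<sigma> j\<bar>"
    by (auto simp: Rmil_B_def)
  have k: "k \<in> {1..int n}"
    using signed_perms_abs_in[OF assms i(1)] i(2,3) by simp
  have inv_k: "inv \<sigma> k = i"
    using i(2) permutes_inverses(2)[OF signed_perms_permutes[OF assms]] by simp
  \<comment> \<open>The value \<open>m\<close> occurs, up to sign, at place
    \<open>\<bar>inv \<sigma> m\<bar>\<close>. This is not \<open>i\<close>, which carries
    \<open>k\<close>, and not later, where all absolute values exceed \<open>k\<close>.\<close>
  have "\<bar>inv \<sigma> m\<bar> < i" if m: "m \<in> {1..<k}" for m
  proof (rule ccontr)
    assume *: "\<not> \<bar>inv \<sigma> m\<bar> < i"
    have m': "m \<in> {1..int n}" using m k by auto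
    note eq = signed_perms_abs_inv'[OF assms m']
    have "\<bar>inv \<sigma> m\<bar> \<noteq> i" using eq i m by auto
    then have "\<bar>inv \<sigma> m\<bar> \<in> {i<..int n}"
      using * signed_perms_abs_in[OF signed_perms_inv[OF assms] m'] by auto
    from less[OF this] eq m show False by simp
  qed
  then show "k \<in> Lmap_B n (inv \<sigma>)"
    using i(1) k inv_k by (auto simp: Lmap_B_def)
next
  fix k assume "k \<in> Lmap_B n (inv \<sigma>)"
  then have k: "k \<in> {1..int n}" "0 < inv \<sigma> k"
    and less: "\<And>m. m \<in> {1..<k} \<Longrightarrow> \<bar>inv \<sigma> m\<bar> < inv \<sigma> k"
    by (auto simp: Lmap_B_def)
  have i: "inv \<sigma> k \<in> {1..int n}"
    using signed_perms_abs_in[OF signed_perms_inv[OF assms] k(1)] k(2) by simp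
  have \<sigma>_i: "\<sigma> (inv \<sigma> k) = k"
    using permutes_inverses(1)[OF signed_perms_permutes[OF assms]] .
  \<comment> \<open>The mirrored argument: a value below \<open>k\<close> would have its place
    before \<open>inv \<sigma> k\<close>, whereas \<open>j\<close> lies after it.\<close>
  have "k < \<bar>\<sigma> j\<bar>" if j: "j \<in> {inv \<sigma> k<..int n}" for j
  proof (rule ccontr)
    assume *: "\<not> k < \<bar>\<sigma> j\<bar>"
    have j': "j \<in> {1..int n}" using j i by auto
    note eq = signed_perms_abs_inv[OF assms j']
    have "\<bar>\<sigma> j\<bar> \<noteq> k" using eq j k(2) by auto
    then have "\<bar>\<sigma> j\<bar> \<in> {1..<k}"
      using * signed_perms_abs_in[OF assms j'] by auto
    from less[OF this] eq j show False by simp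
  qed
  then show "k \<in> Rmil_B n \<sigma>"
    using i \<sigma>_i k(1) unfolding Rmil_B_def by force
qed

lemma Lmap_B_eq_Rmil_B_inv:
  "\<sigma> \<in> signed_perms n \<Longrightarrow> Lmap_B n \<sigma> = Rmil_B n (inv \<sigma>)"
  using Rmil_B_eq_Lmap_B_inv[OF signed_perms_inv] signed_perms_inv_inv by simp

section \<open>Maximal code entries and left-to-right maxima\<close>

lemma finite_Leh_set: "finite {j \<in> {1..i::int}. P j}"
  by (rule finite_subset[of _ "{1..i}"]) auto

text \<open>The entry counts a subset of \<open>{1..k}\<close>, so its size is \<open>k\<close> only
  if every place is counted. The comparison is weak because equal absolute values are still allowed
  here.\<close>

lemma Leh_eq_place_iff:
  assumes "1 \<le> k"
  shows "Leh w k = k \<longleftrightarrow> 0 < w k \<and> (\<forall>j \<in> {1..<k}. \<bar>w j\<bar> \<le> w k)"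
proof -
  let ?A = "{j \<in> {1..k}. \<bar>w j\<bar> \<le> \<bar>w k\<bar>}"
  have "int (card ?A) = k \<longleftrightarrow> ?A = {1..k}"
  proof
    assume "int (card ?A) = k"
    then show "?A = {1..k}" by (intro card_subset_eq) auto
  next
    assume "?A = {1..k}"
    then have "card ?A = card {1..k}" by (rule arg_cong)
    then show "int (card ?A) = k" using assms by simp
  qed
  moreover have "?A = {1..k} \<longleftrightarrow> (\<forall>j \<in> {1..<k}. \<bar>w j\<bar> \<le> \<bar>w k\<bar>)"
  proof -
    have "?A = {1..k} \<longleftrightarrow> (\<forall>j \<in> {1..k}. \<bar>w j\<bar> \<le> \<bar>w k\<bar>)" by blast
    moreover have "(\<forall>j \<in> {1..k}. P j) \<longleftrightarrow> P k \<and> (\<forall>j \<in> {1..<k}. P j)" for P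
      using assms by (metis atLeastAtMost_iff atLeastLessThan_iff order_le_less order_refl)
    ultimately show ?thesis by simp
  qed
  moreover have "Leh w k = k \<longleftrightarrow> 0 < w k \<and> int (card ?A) = k"
  proof (cases "0 < w k")
    \<comment> \<open>A letter that is not positive has a code entry at most 0, which cannot equal
      \<open>k\<close>.\<close>
    case False
    then have "Leh w k \<le> 0" by (simp add: Leh_def sgn_if)
    then show ?thesis using False assms by simp
  qed (simp add: Leh_def)
  ultimately show ?thesis by auto
qed

lemma Lmap_B_eq_Max_places_Leh:
  assumes "inj_on (\<lambda>i. \<bar>w i\<bar>) {1..int n}"
  shows "Lmap_B n w = Max_places n (Leh w)"
proof -
  have "0 < w k \<and> (\<forall>j \<in> {1..<k}. \<bar>w j\<bar> < w k) \<longleftrightarrow> Leh w k = k" if k: "k \<in> {1..int n}" for k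
  proof -
    \<comment> \<open>Injectivity of the absolute values makes the weak comparison strict.\<close>
    have "\<bar>w j\<bar> \<noteq> w k" if "0 < w k" "j \<in> {1..<k}" for j
      using that k inj_onD[OF assms, of j k] by auto
    moreover have "1 \<le> k" using k by simp
    ultimately show ?thesis unfolding Leh_eq_place_iff[OF \<open>1 \<le> k\<close>] by (metis order_le_less)
  qed
  then show ?thesis
    unfolding Lmap_B_def Max_places_def by blast
qed

section \<open>Right-to-left minima of a word and of its code\<close>

lemma abs_Leh:
  "w i \<noteq> 0 \<Longrightarrow> \<bar>Leh w i\<bar> = int (card {j \<in> {1..i}. \<bar>w j\<bar> \<le> \<bar>w i\<bar>})"
  by (simp add: Leh_def abs_mult)

text \<open>Place \<open>i\<close> always counts itself, so the count is nonzero and the sign of the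
  letter survives.\<close>

lemma Leh_pos_iff:
  assumes "1 \<le> i"
  shows "0 < Leh w i \<longleftrightarrow> 0 < w i"
proof -
  have "i \<in> {j \<in> {1..i}. \<bar>w j\<bar> \<le> \<bar>w i\<bar>}" using assms by simp
  with finite_Leh_set have "card {j \<in> {1..i}. \<bar>w j\<bar> \<le> \<bar>w i\<bar>} \<noteq> 0"
    by (metis (no_types) card_eq_0_iff empty_iff)
  then show ?thesis by (simp add: Leh_def zero_less_mult_iff)
qed

text \<open>If all later letters are larger in absolute value, each of them counts what
  \<open>k\<close> counts and also its own place. Conversely, the first later letter that is smaller
  has a count no greater than that of \<open>k\<close>.\<close>

lemma abs_Leh_less_iff_abs_less:
  assumes inj: "inj_on (\<lambda>i. \<bar>w i\<bar>) {1..int n}"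
    and nz: "\<And>i. i \<in> {1..int n} \<Longrightarrow> w i \<noteq> 0"
    and k: "k \<in> {1..int n}"
  shows "(\<forall>j \<in> {k<..int n}. \<bar>Leh w k\<bar> < \<bar>Leh w j\<bar>) \<longleftrightarrow> (\<forall>j \<in> {k<..int n}. \<bar>w k\<bar> < \<bar>w j\<bar>)"
proof
  let ?A = "\<lambda>i. {j \<in> {1..i}. \<bar>w j\<bar> \<le> \<bar>w i\<bar>}"
  assume *: "\<forall>j \<in> {k<..int n}. \<bar>w k\<bar> < \<bar>w j\<bar>"
  show "\<forall>j \<in> {k<..int n}. \<bar>Leh w k\<bar> < \<bar>Leh w j\<bar>"
  proof
    fix j assume j: "j \<in> {k<..int n}"
    then have "\<bar>w k\<bar> < \<bar>w j\<bar>" using * by blast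
    then have "?A k \<subseteq> ?A j" "j \<in> ?A j" "j \<notin> ?A k" using j k by auto
    then have "card (?A k) < card (?A j)" by (intro psubset_card_mono finite_Leh_set) blast
    then show "\<bar>Leh w k\<bar> < \<bar>Leh w j\<bar>" using j k nz[of j] nz[of k] by (simp add: abs_Leh)
  qed
next
  let ?A = "\<lambda>i. {j \<in> {1..i}. \<bar>w j\<bar> \<le> \<bar>w i\<bar>}"
  assume *: "\<forall>j \<in> {k<..int n}. \<bar>Leh w k\<bar> < \<bar>Leh w j\<bar>"
  show "\<forall>j \<in> {k<..int n}. \<bar>w k\<bar> < \<bar>w j\<bar>"
  proof (rule ccontr)
    let ?B = "{j \<in> {k<..int n}. \<bar>w j\<bar> \<le> \<bar>w k\<bar>}"
    assume "\<not> ?thesis"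
    then have B: "?B \<noteq> {}" "finite ?B"
      by (auto simp: not_less intro: finite_subset[of _ "{k<..int n}"])
    \<comment> \<open>The first later letter that is too small contradicts the assumption on the code.\<close>
    define m where "m = Min ?B"
    have "m \<in> ?B" unfolding m_def using B by (intro Min_in)
    then have m: "m \<in> {k<..int n}" and le: "\<bar>w m\<bar> \<le> \<bar>w k\<bar>" by auto
    have less: "\<bar>w m\<bar> < \<bar>w k\<bar>"
      using le m k inj_onD[OF inj, of m k] by (auto simp: order_le_less)
    \<comment> \<open>By minimality of \<open>m\<close>, no place strictly between \<open>k\<close>
      and \<open>m\<close> is counted. Passing from \<open>k\<close> to \<open>m\<close> thus gains
      only \<open>m\<close> and loses \<open>k\<close>.\<close>
    have "?A m \<subseteq> insert m (?A k - {k})"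
    proof
      fix l assume l: "l \<in> ?A m"
      have "l \<notin> {k<..<m}"
      proof
        assume "l \<in> {k<..<m}"
        then have "l \<in> ?B" using l m less by auto
        then have "m \<le> l" unfolding m_def using B by (intro Min_le)
        with \<open>l \<in> {k<..<m}\<close> show False by simp
      qed
      moreover have "l \<noteq> k" using l less by auto
      ultimately show "l \<in> insert m (?A k - {k})" using l less by auto
    qed
    then have "card (?A m) \<le> card (insert m (?A k - {k}))"
      by (intro card_mono finite.insertI finite_Diff finite_Leh_set)
    also have "\<dots> \<le> Suc (card (?A k - {k}))" by (rule card_insert_le_m1) simp_all
    also have "\<dots> = card (?A k)" using k by (intro card_Suc_Diff1 finite_Leh_set) simp
    finally have "\<bar>Leh w m\<bar> \<le> \<bar>Leh w k\<bar>" using m k nz[of m] nz[of k] by (simp add: abs_Leh)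
    then show False using bspec[OF * m] by simp
  qed
qed

text \<open>All of the values \<open>1\<close> to \<open>\<sigma> k\<close> occur, up to sign, at
  places up to \<open>k\<close>, so the count is exactly \<open>\<sigma> k\<close>.\<close>

lemma Leh_eq_letter:
  assumes \<sigma>: "\<sigma> \<in> signed_perms n" and k: "k \<in> {1..int n}"
    and pos: "0 < \<sigma> k" and less: "\<forall>j \<in> {k<..int n}. \<bar>\<sigma> k\<bar> < \<bar>\<sigma> j\<bar>"
  shows "Leh \<sigma> k = \<sigma> k"
proof -
  let ?A = "{j \<in> {1..k}. \<bar>\<sigma> j\<bar> \<le> \<bar>\<sigma> k\<bar>}"
  have "(\<lambda>j. \<bar>\<sigma> j\<bar>) ` ?A = {1..\<sigma> k}"
  proof (intro equalityI subsetI)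
    fix v assume "v \<in> (\<lambda>j. \<bar>\<sigma> j\<bar>) ` ?A"
    then show "v \<in> {1..\<sigma> k}" using k pos signed_perms_abs_in[OF \<sigma>] by force
  next
    fix v assume v: "v \<in> {1..\<sigma> k}"
    then have v': "v \<in> {1..int n}" using signed_perms_abs_in[OF \<sigma> k] by auto
    let ?j = "\<bar>inv \<sigma> v\<bar>"
    have j: "?j \<in> {1..int n}" "\<bar>\<sigma> ?j\<bar> = v"
      using signed_perms_abs_in[OF signed_perms_inv[OF \<sigma>] v'] signed_perms_abs_inv'[OF \<sigma> v'] by auto
    \<comment> \<open>Beyond \<open>k\<close> every absolute value exceeds
      \<open>\<sigma> k\<close>, but \<open>v\<close> does not.\<close>
    then have "?j \<le> k" using v less by force
    then have "?j \<in> ?A" using j v by auto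
    then show "v \<in> (\<lambda>j. \<bar>\<sigma> j\<bar>) ` ?A" using j(2) by force
  qed
  moreover have "inj_on (\<lambda>j. \<bar>\<sigma> j\<bar>) ?A"
    using signed_perms_inj_on_abs[OF \<sigma>] by (rule inj_on_subset) (use k in auto)
  ultimately have "card ?A = card {1..\<sigma> k}" by (metis (lifting) card_image)
  then show ?thesis using pos by (simp add: Leh_def)
qed

text \<open>Separates the places of the minima from the values there, so that the two can be
  compared independently. Writing \<open>\<bar>w i\<bar>\<close> for the positive \<open>w i\<close>
  matches the form of \<open>abs_Leh_less_iff_abs_less\<close>.\<close>

lemma Rmil_B_alt:
  "Rmil_B n w = w ` {i \<in> {1..int n}. 0 < w i \<and> (\<forall>j \<in> {i<..int n}. \<bar>w i\<bar> < \<bar>w j\<bar>)}"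
  by (auto simp: Rmil_B_def)

lemma Rmil_B_Leh:
  assumes \<sigma>: "\<sigma> \<in> signed_perms n"
  shows "Rmil_B n (Leh \<sigma>) = Rmil_B n \<sigma>"
proof -
  have nz: "\<sigma> i \<noteq> 0" if "i \<in> {1..int n}" for i
    using signed_perms_abs_in[OF \<sigma> that] by auto
  have "{i \<in> {1..int n}. 0 < Leh \<sigma> i \<and> (\<forall>j \<in> {i<..int n}. \<bar>Leh \<sigma> i\<bar> < \<bar>Leh \<sigma> j\<bar>)} =
      {i \<in> {1..int n}. 0 < \<sigma> i \<and> (\<forall>j \<in> {i<..int n}. \<bar>\<sigma> i\<bar> < \<bar>\<sigma> j\<bar>)}"
    using abs_Leh_less_iff_abs_less[OF signed_perms_inj_on_abs[OF \<sigma>] nz] Leh_pos_iff[of _ \<sigma>]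
    by (intro Collect_cong) (metis atLeastAtMost_iff)
  then show ?thesis
    unfolding Rmil_B_alt using Leh_eq_letter[OF \<sigma>] by (auto intro!: image_cong)
qed

theorem theorem3p3:
  fixes n :: nat and \<sigma> :: "int \<Rightarrow> int"
  assumes "1 \<le> n"
    and "\<sigma> \<in> signed_perms n"
  shows "Rmil_B n \<sigma> = Max_places n (A_code \<sigma>) \<and> Lmap_B n \<sigma> = Rmil_B n (A_code \<sigma>)"
proof
  note inv = signed_perms_inv[OF assms(2)]
  show "Rmil_B n \<sigma> = Max_places n (A_code \<sigma>)"
    unfolding A_code_def Rmil_B_eq_Lmap_B_inv[OF assms(2)]
    using signed_perms_inj_on_abs[OF inv] by (rule Lmap_B_eq_Max_places_Leh)
  show "Lmap_B n \<sigma> = Rmil_B n (A_code \<sigma>)"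
    unfolding A_code_def Rmil_B_Leh[OF inv] using assms(2) by (rule Lmap_B_eq_Rmil_B_inv)
qed

end
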